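(* Let $0<p,q,u,v\le \infty$. Then, for all $n\in\mathbb{N}$, \[ \|\mathrm{id}\colon \ell_{p,u}^n\to \ell_{q,v}^n\| \asymp \begin{cases} n^{(1/q-1/p)_+} & \text{if } p\neq q \text{ and } p,q<\infty,\\ n^{1/q}(\log (n+1))^{-1/u} & \text{if } q<p=\infty,\\ 1 & \text{if } p<q=\infty,\\ (\log (n+1))^{(1/v-1/u)_+} & \text{if } p=q, \end{cases} \] where $\asymp$ means equivalence up to positive constants independent of $n$ (they may depend on $p,q,u,v$).
   Context: $\log$ is the natural logarithm, $1/\infty=0$, and $(t)_+=\max\{0,t\}$. For $x\in\mathbb{R}^n$, $x_1^*\ge\dots\ge x_n^*\ge 0$ denotes the non-increasing rearrangement of $(|x_1|,\dots,|x_n|)$. For $0<p,u\le\infty$ the Lorentz quasi-norm is $\|x\|_{p,u}:=\big(\sum_{i=1}^n (i^{1/p-1/u}x_i^* )^u\big)^{1/u}$ if $u<\infty$ and $\|x\|_{p,\infty}:=\max_{1\le i\le n} i^{1/p}x_i^*$; $\ell_{p,u}^n=(\mathbb{R}^n,\|\cdot\|_{p,u})$. $\mathrm{id}$ is the identity map of $\mathbb{R}^n$ and $\|\mathrm{id}\colon \ell_{p,u}^n\to \ell_{q,v}^n\|=\sup\{\|x\|_{q,v}: \|x\|_{p,u}\le 1\}$. *)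

theory Defs
  imports "HOL-Library.Extended_Real" "Jordan_Normal_Form.Matrix"
begin

text \<open>Parameters range over \<open>(0, \<infinity>]\<close>, represented by positive extended reals. For these, the
  extended-real quotient \<open>1 / p\<close> is finite, with \<open>1 / \<infinity> = 0\<close>.\<close>

definition recip :: "ereal \<Rightarrow> real" where
  "recip p = real_of_ereal (1 / p)"

text \<open>Indices are counted from 1: \<open>rearr x i\<close> is meant for \<open>1 \<le> i \<le> dim_vec x\<close>.\<close>

definition rearr :: "real vec \<Rightarrow> nat \<Rightarrow> real" where
  "rearr x i = rev (sort (map abs (list_of_vec x))) ! (i - 1)"

text \<open>For \<open>u = \<infinity>\<close> the value is meaningful only for vectors of positive dimension.\<close>

definition lorentz_qnorm :: "ereal \<Rightarrow> ereal \<Rightarrow> real vec \<Rightarrow> real" where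
  "lorentz_qnorm p u x =
    (if u < \<infinity>
     then (\<Sum>i = 1..dim_vec x. (real i powr (recip p - recip u) * rearr x i) powr real_of_ereal u)
            powr recip u
     else Max ((\<lambda>i. real i powr recip p * rearr x i) ` {1..dim_vec x}))"

text \<open>The supremum is taken in the extended reals, so that no boundedness is presupposed.\<close>

definition lorentz_id_norm :: "nat \<Rightarrow> ereal \<Rightarrow> ereal \<Rightarrow> ereal \<Rightarrow> ereal \<Rightarrow> ereal" where
  "lorentz_id_norm n p u q v =
    (SUP x \<in> {x \<in> carrier_vec n. lorentz_qnorm p u x \<le> 1}. ereal (lorentz_qnorm q v x))"

text \<open>The last branch is exactly the case \<open>p = q\<close>, finite or infinite.\<close>

definition lorentz_id_rate :: "nat \<Rightarrow> ereal \<Rightarrow> ereal \<Rightarrow> ereal \<Rightarrow> ereal \<Rightarrow> real" where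
  "lorentz_id_rate n p u q v =
    (if p \<noteq> q \<and> p < \<infinity> \<and> q < \<infinity> then real n powr max 0 (recip q - recip p)
     else if q < p \<and> p = \<infinity> then real n powr recip q * ln (real n + 1) powr (- recip u)
     else if p < q \<and> q = \<infinity> then 1
     else ln (real n + 1) powr max 0 (recip v - recip u))"

end

(* With z i = i^(1/p) x*_i, the Lorentz quasi-norm of x is the L^u norm of z with respect to the
   weights 1/i on {1..n}; this removes p from the norm. Since x* is non-increasing, x*_i times the
   norm of the first i ones is at most the norm of x, and this pointwise bound gives the upper
   estimate for p different from q. For p = q one interpolates with the pointwise bound (u <= v) or
   uses Hoelder's inequality for the total weight harm n (v < u). The lower estimates come from the
   first unit vector, the all-ones vector and, for p = q, the vector with entries i^(-1/p). *)

theory Submission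
  imports Defs "HOL-Analysis.Harmonic_Numbers"
begin

text \<open>For \<open>p\<close> different from \<open>q\<close> the pointwise bound loses only a
  constant: the weighted norm of i^(1/q-1/p) is governed by the indices near n or near 1, according
  to the sign of the exponent. For \<open>p = q\<close> the exponent is 0, every dyadic block of
  indices carries about the same weight, and the pointwise bound alone would in general leave a
  spurious power of \<open>harm n\<close>; hence the separate argument there. Every logarithm comes
  from one source, the total weight \<open>harm n\<close>. For \<open>p = \<infinity>\<close> the
  pointwise bound has a power of \<open>harm i\<close>, so the obstacle is to move the logarithm
  from i to n. Estimates are kept in terms of \<open>harm n\<close>, which appears exactly and is at
  least 1; the passage to \<open>ln (real n + 1)\<close> is made once, at the end. Since
  \<open>p\<close> and \<open>q\<close> act only through \<open>recip\<close>,
  \<open>q = \<infinity>\<close> with finite \<open>p\<close> is just the exponent 0 in the power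
  estimate.\<close>

definition wnorm :: "ereal \<Rightarrow> nat \<Rightarrow> (nat \<Rightarrow> real) \<Rightarrow> real" where
  "wnorm u n z =
    (if u < \<infinity> then (\<Sum>i = 1..n. z i powr real_of_ereal u / real i) powr recip u
     else Max (z ` {1..n}))"

lemma pos_ereal_cases:
  assumes "0 < (u::ereal)"
  obtains r where "0 < r" "u = ereal r" | "u = \<infinity>"
  using assms by (cases u) auto

lemma recip_simps [simp]:
  "recip (ereal r) = 1 / r" "recip \<infinity> = 0"
  by (auto simp: recip_def one_ereal_def divide_ereal_def divide_inverse)

lemma recip_nonneg: "0 < u \<Longrightarrow> 0 \<le> recip u"
  by (erule pos_ereal_cases) auto

lemma wnorm_simps [simp]:
  "wnorm (ereal r) n z = (\<Sum>i = 1..n. z i powr r / real i) powr (1 / r)"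
  "wnorm \<infinity> n z = Max (z ` {1..n})"
  by (simp_all add: wnorm_def)

text \<open>The factor i^(-1/u) inside the Lorentz sum turns into the weight 1/i when raised to the
  power u.\<close>

lemma lorentz_qnorm_eq_wnorm:
  assumes "0 < u"
  shows "lorentz_qnorm p u x = wnorm u (dim_vec x) (\<lambda>i. real i powr recip p * rearr x i)"
  using assms
proof (cases rule: pos_ereal_cases)
  case (1 r)
  have "(real i powr (recip p - 1 / r) * y) powr r = (real i powr recip p * y) powr r / real i"
    if "i \<in> {1..dim_vec x}" for i y
    using that 1 by (simp add: powr_mult powr_powr powr_diff powr_divide)
  then have "(\<Sum>i = 1..dim_vec x. (real i powr (recip p - 1 / r) * rearr x i) powr r) =
    (\<Sum>i = 1..dim_vec x. (real i powr recip p * rearr x i) powr r / real i)"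
    by (intro sum.cong refl)
  with 1 show ?thesis by (simp add: lorentz_qnorm_def)
qed (simp add: lorentz_qnorm_def)

section \<open>Monotonicity, homogeneity and special values of the weighted norm\<close>

text \<open>Two lengths are allowed because the pointwise bound compares the norm over an initial
  segment with the norm over all indices.\<close>

lemma wnorm_mono:
  assumes "0 < u" "1 \<le> m" "m \<le> n"
    and "\<And>i. i \<in> {1..n} \<Longrightarrow> 0 \<le> z i" "\<And>i. i \<in> {1..m} \<Longrightarrow> 0 \<le> y i"
    and "\<And>i. i \<in> {1..m} \<Longrightarrow> y i \<le> z i"
  shows "wnorm u m y \<le> wnorm u n z"
  using assms(1)
proof (cases rule: pos_ereal_cases)
  case (1 r)
  have "(\<Sum>i = 1..m. y i powr r / real i) \<le> (\<Sum>i = 1..m. z i powr r / real i)"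
    using assms 1 by (intro sum_mono divide_right_mono powr_mono2) auto
  also have "\<dots> \<le> (\<Sum>i = 1..n. z i powr r / real i)"
    using assms(3) by (intro sum_mono2) auto
  finally show ?thesis using 1 by (auto intro!: powr_mono2 sum_nonneg)
next
  case 2
  have "y i \<le> Max (z ` {1..n})" if "i \<in> {1..m}" for i
  proof -
    have "y i \<le> z i" using that assms by auto
    also have "\<dots> \<le> Max (z ` {1..n})" using that assms by (intro Max_ge) auto
    finally show ?thesis .
  qed
  then show ?thesis using 2 assms(2) by (auto intro!: Max.boundedI)
qed

lemma wnorm_scale:
  assumes "0 < u" "1 \<le> n" "0 \<le> c"
  shows "wnorm u n (\<lambda>i. c * z i) = c * wnorm u n z"
  using assms(1)
proof (cases rule: pos_ereal_cases)
  case (1 r)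
  have "(\<Sum>i = 1..n. (c * z i) powr r / real i) = c powr r * (\<Sum>i = 1..n. z i powr r / real i)"
    by (simp add: powr_mult sum_distrib_left)
  then show ?thesis using 1 assms(3) by (simp add: powr_mult powr_powr)
next
  case 2
  have "Max ((\<lambda>t. c * t) ` z ` {1..n}) = c * Max (z ` {1..n})"
    using assms by (intro mono_Max_commute[symmetric] monoI mult_left_mono) auto
  then show ?thesis using 2 by (simp add: image_image)
qed

lemma wnorm_cong:
  assumes "\<And>i. i \<in> {1..n} \<Longrightarrow> y i = z i"
  shows "wnorm u n y = wnorm u n z"
proof -
  have "y ` {1..n} = z ` {1..n}" using assms by (intro image_cong refl)
  moreover have "(\<Sum>i = 1..n. y i powr real_of_ereal u / real i) = (\<Sum>i = 1..n. z i powr real_of_ereal u / real i)"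
    using assms by (intro sum.cong refl) simp
  ultimately show ?thesis by (simp only: wnorm_def)
qed

lemma wnorm_const:
  assumes "0 < u" "1 \<le> n"
  shows "wnorm u n (\<lambda>_. 1) = harm n powr recip u"
  using assms(1)
proof (cases rule: pos_ereal_cases)
  case (1 r)
  then show ?thesis by (simp add: harm_def divide_inverse)
next
  case 2
  \<comment> \<open>Since \<open>0 powr 0 = 0\<close>, the value \<open>harm n powr 0 = 1\<close>
    rests on \<open>harm n\<close> being nonzero.\<close>
  have "harm n > (0::real)" using assms(2) by simp
  moreover have "(\<lambda>_. 1::real) ` {1..n} = {1}" using assms(2) by auto
  ultimately show ?thesis using 2 by (simp del: harm_pos_iff)
qed

lemma wnorm_unit:
  assumes "0 < u" "1 \<le> n"
  shows "wnorm u n (\<lambda>i. if i = 1 then 1 else 0) = 1"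
  using assms(1)
proof (cases rule: pos_ereal_cases)
  case (1 r)
  have "(\<Sum>i = 1..n. (if i = 1 then 1 else 0) powr r / real i) = (\<Sum>i = 1..n. if i = 1 then 1 else 0)"
    using 1 by (intro sum.cong) auto
  also have "\<dots> = 1" using assms(2) by (subst sum.delta) auto
  finally show ?thesis using 1 by simp
next
  case 2
  have "Max ((\<lambda>i. if i = 1 then 1 else 0 :: real) ` {1..n}) = 1"
    using assms(2) by (intro Max_eqI) (auto split: if_splits)
  then show ?thesis using 2 by simp
qed

section \<open>Weighted norms of power sequences\<close>

text \<open>For \<open>s \<ge> 1\<close> each term is at most the last one. For \<open>s < 1\<close>
  the mean value theorem bounds s * i^(s-1) by the increment of x^s over [i-1, i], and the
  increments telescope.\<close>

lemma sum_powr_upper: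
  assumes "0 < s"
  shows "\<exists>C>0. \<forall>n\<ge>1. (\<Sum>i = 1..n. real i powr (s - 1)) \<le> C * real n powr s"
proof (cases "s \<ge> 1")
  case True
  have "(\<Sum>i = 1..n. real i powr (s - 1)) \<le> 1 * real n powr s" if "n \<ge> 1" for n
  proof -
    have "(\<Sum>i = 1..n. real i powr (s - 1)) \<le> (\<Sum>i = 1..n. real n powr (s - 1))"
      using True by (intro sum_mono powr_mono2) auto
    also have "\<dots> = real n powr s" using that by (simp add: powr_diff)
    finally show ?thesis by simp
  qed
  then show ?thesis by (intro exI[of _ 1]) auto
next
  case False
  have step: "s * real (Suc i) powr (s - 1) \<le> real (Suc i) powr s - real i powr s" for i
  \<comment> \<open>The interval starting at 0 is treated by hand, since x^s need not be
    differentiable there; with \<open>0 powr s = 0\<close> the claim is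
    \<open>s \<le> 1\<close>.\<close>
  proof (cases "i = 0")
    case True
    then show ?thesis using False by simp
  next
    case i: False
    have "\<exists>z. real i < z \<and> z < real (Suc i) \<and>
      real (Suc i) powr s - real i powr s = (real (Suc i) - real i) * (s * z powr (s - 1))"
      using i by (intro MVT2) (auto intro!: derivative_eq_intros)
    then obtain z where z: "real i < z" "z < real (Suc i)"
      "real (Suc i) powr s - real i powr s = s * z powr (s - 1)" by auto
    have "real (Suc i) powr (s - 1) \<le> z powr (s - 1)"
      using z(1,2) i False by (intro powr_mono2') auto
    with z(3) assms show ?thesis by simp
  qed
  have "s * (\<Sum>i = 1..n. real i powr (s - 1)) \<le> real n powr s" for n
  proof (induction n)
    case (Suc n)
    then show ?case using step[of n] by (simp add: distrib_left)
  qed (use assms in simp)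
  then show ?thesis using assms by (intro exI[of _ "1/s"]) (simp add: field_simps)
qed

text \<open>The mirror image: for \<open>s < 1\<close> the last term is the smallest, for
  \<open>s \<ge> 1\<close> the telescoping estimate is reversed. The value \<open>s = 0\<close> is
  included for the sake of \<open>p = q = \<infinity>\<close>.\<close>

lemma sum_powr_lower:
  assumes "0 \<le> s"
  shows "\<exists>c>0. \<forall>n\<ge>1. c * real n powr s \<le> (\<Sum>i = 1..n. real i powr (s - 1))"
proof (cases "s < 1")
  case True
  have "1 * real n powr s \<le> (\<Sum>i = 1..n. real i powr (s - 1))" if "n \<ge> 1" for n
  proof -
    have "real n powr s = (\<Sum>i = 1..n. real n powr (s - 1))" using that by (simp add: powr_diff)
    also have "\<dots> \<le> (\<Sum>i = 1..n. real i powr (s - 1))"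
      using True by (intro sum_mono powr_mono2') auto
    finally show ?thesis by simp
  qed
  then show ?thesis by (intro exI[of _ 1]) auto
next
  case False
  have step: "real (Suc i) powr s - real i powr s \<le> s * real (Suc i) powr (s - 1)" for i
  proof (cases "i = 0")
    case True
    then show ?thesis using False by simp
  next
    case i: False
    have "\<exists>z. real i < z \<and> z < real (Suc i) \<and>
      real (Suc i) powr s - real i powr s = (real (Suc i) - real i) * (s * z powr (s - 1))"
      using i by (intro MVT2) (auto intro!: derivative_eq_intros)
    then obtain z where z: "real i < z" "z < real (Suc i)"
      "real (Suc i) powr s - real i powr s = s * z powr (s - 1)" by auto
    have "z powr (s - 1) \<le> real (Suc i) powr (s - 1)"
      using z(1,2) i False by (intro powr_mono2) auto
    with z(3) assms show ?thesis by (simp add: mult_left_mono)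
  qed
  have "real n powr s \<le> s * (\<Sum>i = 1..n. real i powr (s - 1))" for n
  proof (induction n)
    case (Suc n)
    then show ?case using step[of n] by (simp add: distrib_left)
  qed (use False in simp)
  then show ?thesis using False by (intro exI[of _ "1/s"]) (simp add: field_simps)
qed

lemma wnorm_powr:
  "wnorm (ereal r) n (\<lambda>i. real i powr a) = (\<Sum>i = 1..n. real i powr (a * r - 1)) powr (1 / r)"
proof -
  have "(\<Sum>i = 1..n. (real i powr a) powr r / real i) = (\<Sum>i = 1..n. real i powr (a * r - 1))"
    by (intro sum.cong refl) (simp add: powr_powr powr_diff)
  then show ?thesis by simp
qed

text \<open>A positive exponent makes the indices comparable with n dominate, so that no logarithm
  appears; at exponent 0 the sum would be \<open>harm n\<close>.\<close>

lemma wnorm_powr_upper: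
  assumes "0 < u" "0 < a"
  shows "\<exists>C>0. \<forall>n\<ge>1. wnorm u n (\<lambda>i. real i powr a) \<le> C * real n powr a"
  using assms(1)
proof (cases rule: pos_ereal_cases)
  case (1 r)
  then obtain C where C: "C > 0"
    "\<And>n. n \<ge> 1 \<Longrightarrow> (\<Sum>i = 1..n. real i powr (a * r - 1)) \<le> C * real n powr (a * r)"
    using sum_powr_upper[of "a * r"] assms by auto
  have "wnorm u n (\<lambda>i. real i powr a) \<le> C powr (1 / r) * real n powr a" if "n \<ge> 1" for n
  proof -
    have "wnorm u n (\<lambda>i. real i powr a) = (\<Sum>i = 1..n. real i powr (a * r - 1)) powr (1 / r)"
      using 1 by (simp only: wnorm_powr)
    also have "\<dots> \<le> (C * real n powr (a * r)) powr (1 / r)"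
      using C(2)[OF that] 1 by (intro powr_mono2 sum_nonneg) auto
    also have "\<dots> = C powr (1 / r) * real n powr a" using 1 by (simp add: powr_mult powr_powr)
    finally show ?thesis .
  qed
  then show ?thesis using C(1) by (intro exI[of _ "C powr (1/r)"]) auto
next
  case 2
  have "wnorm u n (\<lambda>i. real i powr a) \<le> 1 * real n powr a" if "n \<ge> 1" for n
    using 2 that assms by (auto intro!: Max.boundedI powr_mono2)
  then show ?thesis by (intro exI[of _ 1]) auto
qed

lemma wnorm_powr_lower:
  assumes "0 < u" "0 \<le> a"
  shows "\<exists>c>0. \<forall>n\<ge>1. c * real n powr a \<le> wnorm u n (\<lambda>i. real i powr a)"
  using assms(1)
proof (cases rule: pos_ereal_cases)
  case (1 r)
  then obtain c where c: "c > 0"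
    "\<And>n. n \<ge> 1 \<Longrightarrow> c * real n powr (a * r) \<le> (\<Sum>i = 1..n. real i powr (a * r - 1))"
    using sum_powr_lower[of "a * r"] assms by auto
  have "c powr (1 / r) * real n powr a \<le> wnorm u n (\<lambda>i. real i powr a)" if "n \<ge> 1" for n
  proof -
    have "c powr (1 / r) * real n powr a = (c * real n powr (a * r)) powr (1 / r)"
      using 1 by (simp add: powr_mult powr_powr)
    also have "\<dots> \<le> (\<Sum>i = 1..n. real i powr (a * r - 1)) powr (1 / r)"
      using c(2)[OF that] c(1) 1 by (intro powr_mono2) auto
    also have "\<dots> = wnorm u n (\<lambda>i. real i powr a)"
      using 1 by (simp only: wnorm_powr)
    finally show ?thesis .
  qed
  then show ?thesis using c(1) by (intro exI[of _ "c powr (1/r)"]) auto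
next
  case 2
  have "1 * real n powr a \<le> wnorm u n (\<lambda>i. real i powr a)" if "n \<ge> 1" for n
    using 2 that by (auto intro!: Max_ge)
  then show ?thesis by (intro exI[of _ 1]) auto
qed

text \<open>The exponent \<open>a * r - 1\<close> lies below -1, so the partial sums are bounded by
  a convergent series.\<close>

lemma wnorm_powr_neg_bounded:
  assumes "0 < u" "a < 0"
  shows "\<exists>C>0. \<forall>n\<ge>1. wnorm u n (\<lambda>i. real i powr a) \<le> C"
  using assms(1)
proof (cases rule: pos_ereal_cases)
  case (1 r)
  define S where "S = (\<Sum>i. real i powr (a * r - 1))"
  have summ: "summable (\<lambda>i. real i powr (a * r - 1))"
    using assms(2) 1 by (subst summable_real_powr_iff) (simp add: mult_neg_pos)
  have "wnorm u n (\<lambda>i. real i powr a) \<le> (max 1 S) powr (1 / r)" for n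
  proof -
    have "wnorm u n (\<lambda>i. real i powr a) = (\<Sum>i = 1..n. real i powr (a * r - 1)) powr (1 / r)"
      using 1 by (simp only: wnorm_powr)
    also have "(\<Sum>i = 1..n. real i powr (a * r - 1)) \<le> S"
      unfolding S_def by (intro sum_le_suminf summ) auto
    then have "(\<Sum>i = 1..n. real i powr (a * r - 1)) powr (1 / r) \<le> (max 1 S) powr (1 / r)"
      using 1 by (intro powr_mono2 sum_nonneg) auto
    finally show ?thesis .
  qed
  then show ?thesis by (intro exI[of _ "(max 1 S) powr (1/r)"]) (auto simp: max_def)
next
  case 2
  have "wnorm u n (\<lambda>i. real i powr a) \<le> 1" if "n \<ge> 1" for n
    using 2 that assms(2) powr_mono2'[of a 1] by (auto intro!: Max.boundedI)
  then show ?thesis by (intro exI[of _ 1]) auto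
qed

section \<open>Slow growth of the harmonic numbers\<close>

lemma harm_ge_1: "1 \<le> n \<Longrightarrow> (1::real) \<le> harm n"
  using harm_mono[of 1 n, where 'a = real] by (simp add: harm_def)

text \<open>The sequence \<open>harm n - ln n\<close> decreases for n at least 1;
  \<open>decseq_harm_diff_ln\<close> says so for successors, hence the shift by one.\<close>

lemma harm_diff_le_ln:
  assumes "1 \<le> i" "i \<le> n"
  shows "harm n - harm i \<le> ln (real n / real i)"
proof -
  have "harm (Suc (n - 1)) - ln (real (Suc (n - 1))) \<le> harm (Suc (i - 1)) - ln (real (Suc (i - 1)))"
    using decseqD[OF decseq_harm_diff_ln, of "i - 1" "n - 1"] assms by simp
  with assms show ?thesis by (simp add: ln_div)
qed

text \<open>The harmonic numbers grow more slowly than any power, so that the logarithmic factor at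
  \<open>i\<close> may be replaced by the one at \<open>n\<close> at the price of half of the power of \<open>i\<close>.\<close>

lemma wnorm_powr_harm_upper:
  assumes "0 < u" "0 < b" "0 \<le> t"
  shows "\<exists>C>0. \<forall>n\<ge>1. wnorm u n (\<lambda>i. real i powr b * harm i powr (- t)) \<le> C * (real n powr b * harm n powr (- t))"
proof -
  \<comment> \<open>The exponent is so small that (x^e)^t costs at most x^(b/2);
    \<open>t + 1\<close> instead of \<open>t\<close> in the denominator covers
    \<open>t = 0\<close>.\<close>
  define e where "e = b / (2 * (t + 1))"
  have e: "0 < e" "e * t \<le> b / 2"
    using assms by (auto simp: e_def field_simps)
  obtain C where C: "C > 0" "\<And>n. n \<ge> 1 \<Longrightarrow> wnorm u n (\<lambda>i. real i powr (b / 2)) \<le> C * real n powr (b / 2)"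
    using wnorm_powr_upper[of u "b / 2"] assms by auto
  define D where "D = (1 + 1 / e) powr t"
  have D: "D > 0" using e by (simp add: D_def add_pos_pos less_imp_neq[symmetric])
  \<comment> \<open>In essence (harm n / harm i)^t is at most D * (n/i)^(b/2), with D coming from 1
    + ln x being at most (1 + 1/e) * x^e.\<close>
  have pt: "real i powr b * harm i powr (- t) \<le> D * real n powr (b / 2) * harm n powr (- t) * real i powr (b / 2)"
    if i: "i \<in> {1..n}" for i n
  proof -
    define x where "x = real n / real i"
    have x: "x \<ge> 1" using i by (auto simp: x_def)
    have hi: "harm i \<ge> (1::real)" using i by (auto intro: harm_ge_1)
    have hn: "harm n > (0::real)" using i by simp
    have lnx: "0 \<le> ln x" using x by simp
    have "harm n \<le> harm i + ln x" using harm_diff_le_ln[of i n] i by (simp add: x_def)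
    \<comment> \<open>Because \<open>harm i\<close> is at least 1, the additive gap
      \<open>ln x\<close> becomes a factor \<open>1 + ln x\<close>.\<close>
    also have "ln x \<le> harm i * ln x" using mult_right_mono[OF hi lnx] by simp
    finally have "harm n \<le> harm i * (1 + ln x)" by (simp add: distrib_left)
    also have "1 + ln x \<le> (1 + 1 / e) * x powr e"
      using ln_powr_bound[OF x e(1)] ge_one_powr_ge_zero[of x e] x e by (simp add: distrib_right)
    finally have "harm n \<le> harm i * ((1 + 1 / e) * x powr e)" using hi by (simp add: mult_left_mono)
    then have "harm n powr t \<le> (harm i * ((1 + 1 / e) * x powr e)) powr t"
      using hn assms by (intro powr_mono2) (auto intro: harm_nonneg)
    also have "\<dots> = harm i powr t * (D * x powr (e * t))" by (simp add: powr_mult powr_powr D_def)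
    also have "\<dots> \<le> harm i powr t * (D * x powr (b / 2))"
      using x e D by (intro mult_left_mono powr_mono) auto
    also have "x powr (b / 2) = real n powr (b / 2) / real i powr (b / 2)"
      by (simp add: x_def powr_divide)
    finally have "harm n powr t \<le> harm i powr t * (D * (real n powr (b / 2) / real i powr (b / 2)))" .
    moreover have "real i powr b = real i powr (b / 2) * real i powr (b / 2)"
      by (simp flip: powr_add)
    moreover have "harm i powr t > (0::real)" "harm n powr t > (0::real)" "real i powr (b / 2) > 0"
      using hi less_imp_neq[OF hn] i by simp_all
    ultimately show ?thesis
      by (simp add: powr_minus field_simps)
  qed
  have "wnorm u n (\<lambda>i. real i powr b * harm i powr (- t)) \<le> (D * C) * (real n powr b * harm n powr (- t))"
    if n: "n \<ge> 1" for n
  proof -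
    let ?c = "D * real n powr (b / 2) * harm n powr (- t)"
    have "wnorm u n (\<lambda>i. real i powr b * harm i powr (- t)) \<le> wnorm u n (\<lambda>i. ?c * real i powr (b / 2))"
      using n assms D by (intro wnorm_mono pt) auto
    also have "\<dots> = ?c * wnorm u n (\<lambda>i. real i powr (b / 2))"
      using n assms D by (intro wnorm_scale) auto
    also have "\<dots> \<le> ?c * (C * real n powr (b / 2))"
      using C(2)[OF n] D by (intro mult_left_mono) auto
    also have "\<dots> = (D * C) * ((real n powr (b / 2) * real n powr (b / 2)) * harm n powr (- t))"
      by simp
    also have "real n powr (b / 2) * real n powr (b / 2) = real n powr b"
      by (simp flip: powr_add)
    finally show ?thesis .
  qed
  then show ?thesis using C D by (intro exI[of _ "D * C"]) auto
qed

section \<open>From vectors to non-increasing sequences\<close>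

text \<open>On {1..n} these are exactly the rearrangements of vectors of dimension n, by
  \<open>rearranged_rearr\<close> and \<open>rearr_vec\<close>; the supremum can thus be studied on
  sequences.\<close>

definition rearranged :: "nat \<Rightarrow> (nat \<Rightarrow> real) \<Rightarrow> bool" where
  "rearranged n y \<longleftrightarrow> antimono_on {1..n} y \<and> (\<forall>i\<in>{1..n}. 0 \<le> y i)"

lemma rearrangedI:
  assumes "\<And>i j. 1 \<le> i \<Longrightarrow> i \<le> j \<Longrightarrow> j \<le> n \<Longrightarrow> y j \<le> y i" "\<And>i. i \<in> {1..n} \<Longrightarrow> 0 \<le> y i"
  shows "rearranged n y"
  using assms by (auto simp: rearranged_def monotone_on_def)

lemma rearrangedD:
  assumes "rearranged n y"
  shows "1 \<le> i \<Longrightarrow> i \<le> j \<Longrightarrow> j \<le> n \<Longrightarrow> y j \<le> y i" "i \<in> {1..n} \<Longrightarrow> 0 \<le> y i"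
  using assms by (auto simp: rearranged_def monotone_on_def)

lemma rearranged_rearr:
  assumes "dim_vec x = n"
  shows "rearranged n (rearr x)"
proof (rule rearrangedI)
  let ?l = "rev (sort (map abs (list_of_vec x)))"
  have len: "length ?l = n" using assms by simp
  show "rearr x j \<le> rearr x i" if "1 \<le> i" "i \<le> j" "j \<le> n" for i j
    unfolding rearr_def using that len by (intro sorted_rev_nth_mono) auto
  show "0 \<le> rearr x i" if "i \<in> {1..n}" for i
  proof -
    have "?l ! (i - 1) \<in> set ?l" using that len by (intro nth_mem) auto
    then show ?thesis unfolding rearr_def by auto
  qed
qed

text \<open>Taking absolute values and sorting in descending order both fix such a list.\<close>

lemma rearr_vec:
  assumes "rearranged n y" "i \<in> {1..n}"
  shows "rearr (vec_of_list (map y [1..<Suc n])) i = y i"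
proof -
  let ?l = "map y [1..<Suc n]"
  have abs: "map abs (list_of_vec (vec_of_list ?l)) = ?l"
    using rearrangedD(2)[OF assms(1)] by (auto simp: list_vec simp del: upt_Suc vec_of_list_map)
  have "sorted (rev ?l)"
    unfolding sorted_rev_iff_nth_mono using rearrangedD(1)[OF assms(1)] by (auto simp del: upt_Suc)
  then have "sort ?l = rev ?l" by (intro properties_for_sort) simp_all
  moreover have "?l ! (i - 1) = y i"
    using assms(2) by (subst nth_map) (auto simp: nth_upt simp del: upt_Suc)
  ultimately show ?thesis unfolding rearr_def abs by (simp only: rev_rev_ident)
qed

lemma lorentz_id_norm_le:
  assumes "0 < u" "0 < v"
    and "\<And>y. rearranged n y \<Longrightarrow> wnorm u n (\<lambda>i. real i powr recip p * y i) \<le> 1 \<Longrightarrow>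
      wnorm v n (\<lambda>i. real i powr recip q * y i) \<le> K"
  shows "lorentz_id_norm n p u q v \<le> ereal K"
  unfolding lorentz_id_norm_def
proof (rule SUP_least)
  fix x assume "x \<in> {x \<in> carrier_vec n. lorentz_qnorm p u x \<le> 1}"
  then have x: "dim_vec x = n" "lorentz_qnorm p u x \<le> 1" by auto
  have "wnorm v n (\<lambda>i. real i powr recip q * rearr x i) \<le> K"
    using x assms(1) by (intro assms(3)) (simp_all add: lorentz_qnorm_eq_wnorm rearranged_rearr)
  then show "ereal (lorentz_qnorm q v x) \<le> ereal K"
    using x assms(2) by (simp add: lorentz_qnorm_eq_wnorm)
qed

text \<open>Dividing the test sequence by K puts it into the unit ball, and homogeneity gives the
  quotient. One-sided bounds K and L suffice, so the norms of a test sequence need not be known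
  exactly.\<close>

lemma lorentz_id_norm_ge:
  assumes "0 < u" "0 < v" "1 \<le> n" "rearranged n y" "0 < K"
    and "wnorm u n (\<lambda>i. real i powr recip p * y i) \<le> K"
    and "L \<le> wnorm v n (\<lambda>i. real i powr recip q * y i)"
  shows "ereal (L / K) \<le> lorentz_id_norm n p u q v"
proof -
  define x where "x = vec_of_list (map (\<lambda>i. y i / K) [1..<Suc n])"
  have dim: "dim_vec x = n" by (simp add: x_def)
  have "rearranged n (\<lambda>i. y i / K)"
    using rearrangedD[OF assms(4)] assms(5) by (intro rearrangedI divide_right_mono) auto
  from rearr_vec[OF this] have x: "rearr x i = y i / K" if "i \<in> {1..n}" for i
    using that unfolding x_def by blast
  have norm: "lorentz_qnorm p' w x = wnorm w n (\<lambda>i. real i powr recip p' * y i) / K" if "0 < w" for p' w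
  proof -
    have "lorentz_qnorm p' w x = wnorm w n (\<lambda>i. real i powr recip p' * rearr x i)"
      using that by (simp add: lorentz_qnorm_eq_wnorm dim)
    also have "\<dots> = wnorm w n (\<lambda>i. 1 / K * (real i powr recip p' * y i))"
      by (intro wnorm_cong) (simp add: x)
    also have "\<dots> = wnorm w n (\<lambda>i. real i powr recip p' * y i) / K"
      using that assms by (subst wnorm_scale) auto
    finally show ?thesis .
  qed
  have "ereal (L / K) \<le> ereal (lorentz_qnorm q v x)"
    using assms by (simp add: norm divide_right_mono)
  also have "ereal (lorentz_qnorm q v x) \<le> lorentz_id_norm n p u q v"
  proof -
    have "lorentz_qnorm p u x \<le> 1"
      using assms(5,6) norm[OF assms(1), of p] by simp
    then have "x \<in> {x \<in> carrier_vec n. lorentz_qnorm p u x \<le> 1}"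
      using dim carrier_vecI by blast
    then show ?thesis
      unfolding lorentz_id_norm_def by (rule SUP_upper)
  qed
  finally show ?thesis .
qed

section \<open>Pointwise bound, interpolation and Hoelder's inequality\<close>

lemma wnorm_pointwise:
  assumes "0 < u" "rearranged n y" "i \<in> {1..n}"
  shows "y i * wnorm u i (\<lambda>j. real j powr a) \<le> wnorm u n (\<lambda>j. real j powr a * y j)"
proof -
  have "y i * wnorm u i (\<lambda>j. real j powr a) = wnorm u i (\<lambda>j. y i * real j powr a)"
    using assms rearrangedD[OF assms(2)] by (intro wnorm_scale[symmetric]) auto
  also have "\<dots> \<le> wnorm u n (\<lambda>j. real j powr a * y j)"
    using assms rearrangedD[OF assms(2)]
    by (intro wnorm_mono) (auto simp: mult.commute intro!: mult_left_mono)
  finally show ?thesis .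
qed

text \<open>This is the embedding of the Lorentz space with second index u into the weak space with
  second index infinity, uniformly in n.\<close>

lemma wnorm_pointwise_powr:
  assumes "0 < u" "0 \<le> a"
  shows "\<exists>C>0. \<forall>n y. \<forall>i\<in>{1..n}. rearranged n y \<longrightarrow> wnorm u n (\<lambda>j. real j powr a * y j) \<le> 1 \<longrightarrow>
    real i powr a * y i \<le> C"
proof -
  obtain c where c: "c > 0" "\<And>n. n \<ge> 1 \<Longrightarrow> c * real n powr a \<le> wnorm u n (\<lambda>i. real i powr a)"
    using wnorm_powr_lower[OF assms] by auto
  have "real i powr a * y i \<le> 1 / c"
    if "i \<in> {1..n}" "rearranged n y" "wnorm u n (\<lambda>j. real j powr a * y j) \<le> 1" for n y i
  proof -
    have "y i * (c * real i powr a) \<le> y i * wnorm u i (\<lambda>j. real j powr a)"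
      using c(2)[of i] that rearrangedD(2)[OF that(2,1)] by (intro mult_left_mono) auto
    also have "\<dots> \<le> 1" using wnorm_pointwise[OF assms(1) that(2,1), of a] that(3) by simp
    finally show ?thesis using c(1) by (simp add: field_simps)
  qed
  then show ?thesis using c(1) by (intro exI[of _ "1 / c"]) auto
qed

lemma sum_le_one_if_wnorm_le_one:
  assumes "0 < r" "wnorm (ereal r) n z \<le> 1"
  shows "(\<Sum>i = 1..n. z i powr r / real i) \<le> 1"
proof -
  let ?S = "\<Sum>i = 1..n. z i powr r / real i"
  have S: "0 \<le> ?S" by (intro sum_nonneg) auto
  have "(?S powr (1 / r)) powr r \<le> 1 powr r"
    using assms by (intro powr_mono2) auto
  then show ?thesis using assms S by (simp add: powr_powr)
qed

text \<open>Writing z^s = z^(s-r) * z^r, the first factor is absorbed by the bound K. As the weights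
  1/i become small, \<open>wnorm u n z \<le> 1\<close> gives no such bound uniformly in n; in the
  application it comes from monotonicity.\<close>

lemma wnorm_interpolate:
  assumes "0 < u" "u \<le> v" "0 < K"
  shows "\<exists>C>0. \<forall>n\<ge>1. \<forall>z. (\<forall>i\<in>{1..n}. 0 \<le> z i \<and> z i \<le> K) \<longrightarrow> wnorm u n z \<le> 1 \<longrightarrow> wnorm v n z \<le> C"
proof (cases v)
  case (real s)
  with assms obtain r where r: "u = ereal r" "0 < r" "r \<le> s" by (cases u) auto
  have "wnorm v n z \<le> (K powr (s - r)) powr (1 / s)"
    if z: "\<And>i. i \<in> {1..n} \<Longrightarrow> 0 \<le> z i \<and> z i \<le> K" and le: "wnorm u n z \<le> 1" for n z
  proof -
    have "(\<Sum>i = 1..n. z i powr s / real i) \<le> (\<Sum>i = 1..n. K powr (s - r) * (z i powr r / real i))"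
    proof (intro sum_mono)
      fix i assume i: "i \<in> {1..n}"
      have "z i powr s = z i powr (s - r) * z i powr r" by (simp flip: powr_add)
      also have "\<dots> \<le> K powr (s - r) * z i powr r"
        using z[OF i] r by (intro mult_right_mono powr_mono2) auto
      finally show "z i powr s / real i \<le> K powr (s - r) * (z i powr r / real i)"
        by (simp add: divide_right_mono)
    qed
    also have "\<dots> = K powr (s - r) * (\<Sum>i = 1..n. z i powr r / real i)"
      by (simp add: sum_distrib_left)
    also have "\<dots> \<le> K powr (s - r) * 1"
      using sum_le_one_if_wnorm_le_one[of r n z] r le by (intro mult_left_mono) auto
    finally show ?thesis
      using real r by (auto intro!: powr_mono2 sum_nonneg)
  qed
  then show ?thesis using assms by (intro exI[of _ "(K powr (s - r)) powr (1 / s)"]) auto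
next
  case PInf
  have "wnorm v n z \<le> K" if "n \<ge> 1" "\<And>i. i \<in> {1..n} \<Longrightarrow> z i \<le> K" for n z
    using PInf that by (auto intro!: Max.boundedI)
  then show ?thesis using assms by (intro exI[of _ K]) auto
qed (use assms in auto)

text \<open>Splitting at a threshold \<open>t\<close> gives \<open>z powr s \<le> t powr s + t powr (s - r) * z powr r\<close> for
  \<open>s < r\<close>; the choice \<open>t = harm n powr (- 1 / r)\<close> balances the two terms, so that Hoelder's
  inequality is obtained up to a constant.\<close>

lemma wnorm_hoelder:
  assumes "0 < v" "v < u" "1 \<le> n" "\<And>i. i \<in> {1..n} \<Longrightarrow> 0 \<le> z i" "wnorm u n z \<le> 1"
  shows "wnorm v n z \<le> 2 powr recip v * harm n powr (recip v - recip u)"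
proof -
  define H where "H = (harm n :: real)"
  have H: "H > 0" "(\<Sum>i = 1..n. 1 / real i) = H"
    using assms(3) by (simp add: H_def, simp add: H_def harm_def divide_inverse)
  obtain s where s: "v = ereal s" "0 < s" using assms by (cases v) auto
  have "(\<Sum>i = 1..n. z i powr s / real i) \<le> 2 * H powr (1 - s * recip u)"
  proof (cases u)
    case (real r)
    with s assms have r: "s < r" "0 < r" by auto
    define t where "t = H powr (- 1 / r)"
    have t: "t > 0" "t powr w = H powr (- w / r)" for w using H by (auto simp: t_def powr_powr)
    have "(\<Sum>i = 1..n. z i powr s / real i) \<le>
      (\<Sum>i = 1..n. t powr s * (1 / real i) + t powr (s - r) * (z i powr r / real i))"
    proof (intro sum_mono)
      fix i assume i: "i \<in> {1..n}"
      have "z i powr s \<le> t powr s + t powr (s - r) * z i powr r"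
      proof (cases "z i \<le> t")
        case True
        then have "z i powr s \<le> t powr s" using assms(4)[OF i] s by (intro powr_mono2) auto
        then show ?thesis by (simp add: add_increasing2)
      next
        case False
        have "z i powr s = z i powr (s - r) * z i powr r" by (simp flip: powr_add)
        also have "\<dots> \<le> t powr (s - r) * z i powr r"
          using False r t by (intro mult_right_mono powr_mono2') auto
        finally show ?thesis by (simp add: add_increasing)
      qed
      then have "z i powr s / real i \<le> (t powr s + t powr (s - r) * z i powr r) / real i"
        by (rule divide_right_mono) simp
      then show "z i powr s / real i \<le> t powr s * (1 / real i) + t powr (s - r) * (z i powr r / real i)"
        by (simp add: add_divide_distrib)
    qed
    also have "\<dots> = t powr s * H + t powr (s - r) * (\<Sum>i = 1..n. z i powr r / real i)"
      by (simp only: sum.distrib sum_distrib_left[symmetric] H)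
    also have "\<dots> \<le> t powr s * H + t powr (s - r) * 1"
      using sum_le_one_if_wnorm_le_one[of r n z] r real assms(5)
      by (intro add_left_mono mult_left_mono) auto
    also have "t powr s * H = H powr (1 - s / r)"
      using H by (simp add: t powr_diff powr_minus divide_inverse)
    also have "t powr (s - r) = H powr (1 - s / r)"
      using r by (simp add: t diff_divide_distrib)
    finally show ?thesis using real by simp
  next
    case PInf
    \<comment> \<open>For \<open>u = \<infinity>\<close> the sum is at most the total weight H, and
      \<open>recip u = 0\<close> makes the exponent of H equal to 1.\<close>
    have "z i \<le> 1" if "i \<in> {1..n}" for i
      using Max_ge[of "z ` {1..n}" "z i"] that assms(5) PInf by simp
    then have "z i powr s \<le> 1" if "i \<in> {1..n}" for i
      using that assms(4)[OF that] s powr_mono2[of s "z i" 1] by simp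
    then have "(\<Sum>i = 1..n. z i powr s / real i) \<le> (\<Sum>i = 1..n. 1 / real i)"
      by (intro sum_mono divide_right_mono) auto
    then show ?thesis using H PInf by simp
  qed (use assms in auto)
  then have "(\<Sum>i = 1..n. z i powr s / real i) powr (1 / s) \<le> (2 * H powr (1 - s * recip u)) powr (1 / s)"
    using s by (intro powr_mono2 sum_nonneg) auto
  also have "\<dots> = 2 powr (1 / s) * H powr (1 / s - recip u)"
    using s by (simp add: powr_mult powr_powr diff_divide_distrib)
  finally show ?thesis using s by (simp add: H_def)
qed

text \<open>The all-ones vector at \<open>p = \<infinity>\<close>, where \<open>recip p = 0\<close>;
  this is the source of the logarithm in that case.\<close>

lemma wnorm_powr_0:
  assumes "0 < u" "1 \<le> n"
  shows "wnorm u n (\<lambda>i. real i powr 0) = harm n powr recip u"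
proof -
  have "wnorm u n (\<lambda>i. real i powr 0) = wnorm u n (\<lambda>_. 1)"
    by (intro wnorm_cong) simp
  then show ?thesis using assms by (simp only: wnorm_const)
qed

lemma recip_antimono:
  assumes "0 < u" "u \<le> v"
  shows "recip v \<le> recip u"
  using assms by (cases u; cases v) (auto simp: frac_le)

section \<open>Upper estimates\<close>

text \<open>The pointwise bound y_i <= K * i^(-1/p) leaves the weighted norm of i^(1/q-1/p), which
  grows like that power of n if the exponent is positive and stays bounded if it is
  negative.\<close>

lemma lorentz_id_norm_upper_powr:
  assumes "0 < u" "0 < v" "0 < recip p" "recip p \<noteq> recip q"
  shows "\<exists>C>0. \<forall>n\<ge>1. lorentz_id_norm n p u q v \<le> ereal (C * real n powr max 0 (recip q - recip p))"
proof -
  define a b m where "a = recip p" and "b = recip q" and "m = max 0 (b - a)"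
  obtain K where K: "K > 0" "\<And>n y i. i \<in> {1..n} \<Longrightarrow> rearranged n y \<Longrightarrow>
    wnorm u n (\<lambda>j. real j powr a * y j) \<le> 1 \<Longrightarrow> real i powr a * y i \<le> K"
    using wnorm_pointwise_powr[of u a] assms unfolding a_def by (auto simp: less_imp_le)
  obtain C where C: "C > 0" "\<And>n. n \<ge> 1 \<Longrightarrow> wnorm v n (\<lambda>i. real i powr (b - a)) \<le> C * real n powr m"
  proof (cases "a < b")
    case True
    then show ?thesis using wnorm_powr_upper[of v "b - a"] assms that by (auto simp: m_def)
  next
    case False
    with assms have "b - a < 0" by (simp add: a_def b_def)
    then show ?thesis using wnorm_powr_neg_bounded[of v "b - a"] assms that by (auto simp: m_def)
  qed
  have "lorentz_id_norm n p u q v \<le> ereal (K * C * real n powr m)" if n: "n \<ge> 1" for n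
  proof (rule lorentz_id_norm_le[OF assms(1,2)])
    fix y assume y: "rearranged n y" "wnorm u n (\<lambda>i. real i powr recip p * y i) \<le> 1"
    have pt: "real i powr b * y i \<le> K * real i powr (b - a)" if i: "i \<in> {1..n}" for i
    proof -
      have "real i powr b * y i = real i powr (b - a) * (real i powr a * y i)"
        using i by (simp add: powr_diff)
      also have "\<dots> \<le> real i powr (b - a) * K"
        using K(2)[OF i y(1)] y(2) by (intro mult_left_mono) (auto simp: a_def)
      finally show ?thesis by (simp add: mult.commute)
    qed
    have "wnorm v n (\<lambda>i. real i powr b * y i) \<le> wnorm v n (\<lambda>i. K * real i powr (b - a))"
      using assms n K(1) pt rearrangedD(2)[OF y(1)] by (intro wnorm_mono) auto
    also have "\<dots> = K * wnorm v n (\<lambda>i. real i powr (b - a))"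
      using assms n K(1) by (intro wnorm_scale) auto
    also have "\<dots> \<le> K * (C * real n powr m)"
      using C(2)[OF n] K(1) by (intro mult_left_mono) auto
    finally show "wnorm v n (\<lambda>i. real i powr recip q * y i) \<le> K * C * real n powr m"
      by (simp add: b_def mult.assoc)
  qed
  then show ?thesis using K(1) C(1) unfolding m_def a_def b_def by (intro exI[of _ "K * C"]) auto
qed

text \<open>The first i ones have norm \<open>harm i powr recip u\<close>, so y_i is at most the
  reciprocal of this; \<open>wnorm_powr_harm_upper\<close> then moves the harmonic factor from i to
  n.\<close>

lemma lorentz_id_norm_upper_top:
  assumes "0 < u" "0 < v" "recip p = 0" "0 < recip q"
  shows "\<exists>C>0. \<forall>n\<ge>1. lorentz_id_norm n p u q v \<le> ereal (C * (real n powr recip q * harm n powr (- recip u)))"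
proof -
  obtain C where C: "C > 0" "\<And>n. n \<ge> 1 \<Longrightarrow> wnorm v n (\<lambda>i. real i powr recip q * harm i powr (- recip u))
      \<le> C * (real n powr recip q * harm n powr (- recip u))"
    using wnorm_powr_harm_upper[of v "recip q" "recip u"] assms recip_nonneg by auto
  have "lorentz_id_norm n p u q v \<le> ereal (C * (real n powr recip q * harm n powr (- recip u)))"
    if n: "n \<ge> 1" for n
  proof (rule lorentz_id_norm_le[OF assms(1,2)])
    fix y assume y: "rearranged n y" "wnorm u n (\<lambda>i. real i powr recip p * y i) \<le> 1"
    have pt: "y i \<le> harm i powr (- recip u)" if i: "i \<in> {1..n}" for i
    proof -
      have "harm i powr recip u > (0::real)" using harm_ge_1[of i] i by simp
      moreover have "y i * harm i powr recip u \<le> 1"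
        using wnorm_pointwise[OF assms(1) y(1) i, of 0] y(2) wnorm_powr_0[OF assms(1), of i] i assms(3)
        by (simp only: atLeastAtMost_iff)
      ultimately show ?thesis by (simp add: powr_minus field_simps)
    qed
    have "wnorm v n (\<lambda>i. real i powr recip q * y i) \<le> wnorm v n (\<lambda>i. real i powr recip q * harm i powr (- recip u))"
      using assms n pt rearrangedD(2)[OF y(1)] by (intro wnorm_mono mult_left_mono) auto
    also have "\<dots> \<le> C * (real n powr recip q * harm n powr (- recip u))" by (rule C(2)[OF n])
    finally show "wnorm v n (\<lambda>i. real i powr recip q * y i) \<le> C * (real n powr recip q * harm n powr (- recip u))" .
  qed
  then show ?thesis using C(1) by auto
qed

lemma lorentz_id_norm_upper_eq:
  assumes "0 < u" "0 < v" "0 < p"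
  shows "\<exists>C>0. \<forall>n\<ge>1. lorentz_id_norm n p u p v \<le> ereal (C * harm n powr max 0 (recip v - recip u))"
proof (cases "u \<le> v")
  case True
  define a where "a = recip p"
  obtain K where K: "K > 0" "\<And>n y i. i \<in> {1..n} \<Longrightarrow> rearranged n y \<Longrightarrow>
    wnorm u n (\<lambda>j. real j powr a * y j) \<le> 1 \<Longrightarrow> real i powr a * y i \<le> K"
    using wnorm_pointwise_powr[of u a] assms recip_nonneg[of p] unfolding a_def by auto
  obtain C where C: "C > 0" "\<And>n z. n \<ge> 1 \<Longrightarrow> (\<And>i. i \<in> {1..n} \<Longrightarrow> 0 \<le> z i \<and> z i \<le> K) \<Longrightarrow>
    wnorm u n z \<le> 1 \<Longrightarrow> wnorm v n z \<le> C"
    using wnorm_interpolate[OF assms(1) True K(1)] by metis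
  have "lorentz_id_norm n p u p v \<le> ereal (C * harm n powr max 0 (recip v - recip u))" if n: "n \<ge> 1" for n
  proof (rule lorentz_id_norm_le[OF assms(1,2)])
    fix y assume y: "rearranged n y" "wnorm u n (\<lambda>i. real i powr recip p * y i) \<le> 1"
    have "wnorm v n (\<lambda>i. real i powr recip p * y i) \<le> C"
      using K(2)[OF _ y(1)] y(2) rearrangedD(2)[OF y(1)] n by (intro C(2)) (auto simp: a_def)
    moreover have "max 0 (recip v - recip u) = 0" using recip_antimono[OF assms(1) True] by simp
    ultimately show "wnorm v n (\<lambda>i. real i powr recip p * y i) \<le> C * harm n powr max 0 (recip v - recip u)"
      using harm_ge_1[OF n] by simp
  qed
  then show ?thesis using C(1) by auto
next
  case False
  define C where "C = (2::real) powr recip v"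
  have max: "max 0 (recip v - recip u) = recip v - recip u"
    using recip_antimono[of v u] assms False by simp
  have "lorentz_id_norm n p u p v \<le> ereal (C * harm n powr max 0 (recip v - recip u))" if n: "n \<ge> 1" for n
  proof (rule lorentz_id_norm_le[OF assms(1,2)])
    fix y assume y: "rearranged n y" "wnorm u n (\<lambda>i. real i powr recip p * y i) \<le> 1"
    show "wnorm v n (\<lambda>i. real i powr recip p * y i) \<le> C * harm n powr max 0 (recip v - recip u)"
      unfolding max C_def using assms False n y rearrangedD(2)[OF y(1)] by (intro wnorm_hoelder) auto
  qed
  then show ?thesis by (intro exI[of _ C]) (auto simp: C_def)
qed

section \<open>Lower estimates from test sequences\<close>

lemma lorentz_id_norm_ge_1:
  assumes "0 < u" "0 < v" "1 \<le> n"
  shows "1 \<le> lorentz_id_norm n p u q v"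
proof -
  define y where "y = (\<lambda>i::nat. if i = 1 then 1 else 0 :: real)"
  have "wnorm w n (\<lambda>i. real i powr a * y i) = 1" if "0 < w" for w a
  proof -
    \<comment> \<open>Only the index 1 counts, and \<open>1 powr a = 1\<close>, so the unit vector
      has norm 1 in every Lorentz space.\<close>
    have "wnorm w n (\<lambda>i. real i powr a * y i) = wnorm w n y"
      by (intro wnorm_cong) (simp add: y_def)
    then show ?thesis using wnorm_unit[OF that assms(3)] unfolding y_def by simp
  qed
  moreover have "rearranged n y" by (intro rearrangedI) (auto simp: y_def)
  ultimately show ?thesis
    using lorentz_id_norm_ge[of u v n y 1 p 1 q] assms by (simp add: one_ereal_def)
qed

lemma rearranged_1: "rearranged n (\<lambda>_. 1)"
  by (intro rearrangedI) auto

text \<open>The all-ones vector has quasi-norms of order n^(1/p) and n^(1/q). The quotient is of the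
  right order when the exponent is non-negative; otherwise the unit vector does better.\<close>

lemma lorentz_id_norm_lower_powr:
  assumes "0 < u" "0 < v" "0 < recip p" "0 \<le> recip q"
  shows "\<exists>c>0. \<forall>n\<ge>1. ereal (c * real n powr (recip q - recip p)) \<le> lorentz_id_norm n p u q v"
proof -
  obtain c where c: "c > 0" "\<And>n. n \<ge> 1 \<Longrightarrow> c * real n powr recip q \<le> wnorm v n (\<lambda>i. real i powr recip q)"
    using wnorm_powr_lower[of v "recip q"] assms by auto
  obtain C where C: "C > 0" "\<And>n. n \<ge> 1 \<Longrightarrow> wnorm u n (\<lambda>i. real i powr recip p) \<le> C * real n powr recip p"
    using wnorm_powr_upper[of u "recip p"] assms by auto
  have "ereal (c / C * real n powr (recip q - recip p)) \<le> lorentz_id_norm n p u q v" if n: "n \<ge> 1" for n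
  proof -
    have "ereal (c * real n powr recip q / (C * real n powr recip p)) \<le> lorentz_id_norm n p u q v"
      using assms n c(2)[OF n] C(1) C(2)[OF n] by (intro lorentz_id_norm_ge[OF _ _ _ rearranged_1]) auto
    then show ?thesis by (simp add: powr_diff)
  qed
  then show ?thesis using c(1) C(1) by (intro exI[of _ "c / C"]) auto
qed

lemma lorentz_id_norm_lower_top:
  assumes "0 < u" "0 < v" "recip p = 0" "0 \<le> recip q"
  shows "\<exists>c>0. \<forall>n\<ge>1. ereal (c * (real n powr recip q * harm n powr (- recip u))) \<le> lorentz_id_norm n p u q v"
proof -
  obtain c where c: "c > 0" "\<And>n. n \<ge> 1 \<Longrightarrow> c * real n powr recip q \<le> wnorm v n (\<lambda>i. real i powr recip q)"
    using wnorm_powr_lower[of v "recip q"] assms by auto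
  have "ereal (c * (real n powr recip q * harm n powr (- recip u))) \<le> lorentz_id_norm n p u q v" if n: "n \<ge> 1" for n
  proof -
    have "wnorm u n (\<lambda>i. real i powr recip p * 1) \<le> harm n powr recip u"
      using wnorm_powr_0[OF assms(1) n] assms(3) by (simp only: mult_1_right order_refl)
    moreover have "harm n powr recip u > (0::real)" using harm_ge_1[OF n] by simp
    ultimately have "ereal (c * real n powr recip q / harm n powr recip u) \<le> lorentz_id_norm n p u q v"
      using assms n c(2)[OF n] by (intro lorentz_id_norm_ge[OF _ _ _ rearranged_1]) auto
    then show ?thesis by (simp add: powr_minus divide_inverse mult.assoc)
  qed
  then show ?thesis using c(1) by auto
qed

text \<open>The entries i^(-1/p) make the weighted sequence constant 1, the equality case of
  Hoelder's inequality, and both norms are exact powers of \<open>harm n\<close>.\<close>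

lemma lorentz_id_norm_lower_eq:
  assumes "0 < u" "0 < v" "0 < p" "1 \<le> n"
  shows "ereal (harm n powr (recip v - recip u)) \<le> lorentz_id_norm n p u p v"
proof -
  define y where "y = (\<lambda>i. real i powr (- recip p))"
  have y: "rearranged n y"
    using recip_nonneg[OF assms(3)] by (intro rearrangedI) (auto simp: y_def intro!: powr_mono2')
  have norm: "wnorm w n (\<lambda>i. real i powr recip p * y i) = harm n powr recip w" if "0 < w" for w
  proof -
    have "wnorm w n (\<lambda>i. real i powr recip p * y i) = wnorm w n (\<lambda>_. 1)"
      by (intro wnorm_cong) (simp add: y_def powr_minus)
    then show ?thesis using wnorm_const[OF that assms(4)] by simp
  qed
  have "harm n powr recip u > (0::real)" using harm_ge_1[OF assms(4)] by simp
  then have "ereal (harm n powr recip v / harm n powr recip u) \<le> lorentz_id_norm n p u p v"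
    using assms y by (intro lorentz_id_norm_ge) (auto simp: norm)
  then show ?thesis by (simp add: powr_diff)
qed

section \<open>From harmonic numbers to the logarithm\<close>

text \<open>Both signs of s occur: -1/u for \<open>p = \<infinity>\<close> and (1/v-1/u)_+ for
  \<open>p = q\<close>. For negative s the two bounds on \<open>harm n\<close> exchange their
  roles.\<close>

lemma harm_powr_asymp_ln:
  fixes s :: real
  shows "\<exists>c C. 0 < c \<and> 0 < C \<and> (\<forall>n\<ge>1. c * ln (real n + 1) powr s \<le> harm n powr s \<and>
    harm n powr s \<le> C * ln (real n + 1) powr s)"
proof -
  \<comment> \<open>In \<open>harm n \<le> 1 + ln n\<close> the term 1 is at most
    \<open>ln (real n + 1) / ln 2\<close>, with equality at n = 1, and \<open>ln n\<close> is at
    most \<open>ln (real n + 1)\<close>.\<close>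
  define D :: real where "D = 1 / ln 2 + 1"
  have D: "D > 0" by (simp add: D_def add_pos_pos)
  have bounds: "0 < ln (real n + 1)" "ln (real n + 1) \<le> harm n" "harm n \<le> D * ln (real n + 1)"
    if n: "n \<ge> 1" for n
  proof -
    show "0 < ln (real n + 1)" using n by simp
    show "ln (real n + 1) \<le> harm n" by (rule ln_le_harm)
    have "harm n \<le> 1 + ln (real n)"
      using harm_diff_le_ln[of 1 n] n by (simp add: harm_def)
    also have "1 \<le> ln (real n + 1) / ln 2" using n by simp
    also have "ln (real n) \<le> ln (real n + 1)" using n by simp
    finally show "harm n \<le> D * ln (real n + 1)" by (simp add: D_def distrib_right)
  qed
  show ?thesis
  proof (cases "s \<ge> 0")
    case True
    have "ln (real n + 1) powr s \<le> harm n powr s" "harm n powr s \<le> D powr s * ln (real n + 1) powr s"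
      if n: "n \<ge> 1" for n
      using bounds[OF n] True powr_mono2[of s "ln (real n + 1)" "harm n"]
        powr_mono2[of s "harm n" "D * ln (real n + 1)"] by (simp_all add: powr_mult harm_nonneg)
    then show ?thesis using D by (intro exI[of _ 1] exI[of _ "D powr s"]) auto
  next
    case False
    have "harm n powr s \<le> ln (real n + 1) powr s" "D powr s * ln (real n + 1) powr s \<le> harm n powr s"
      if n: "n \<ge> 1" for n
      using bounds[OF n] False powr_mono2'[of s "ln (real n + 1)" "harm n"]
        powr_mono2'[of s "harm n" "D * ln (real n + 1)"] by (simp_all add: powr_mult)
    then show ?thesis using D by (intro exI[of _ "D powr s"] exI[of _ 1]) auto
  qed
qed

lemma harm_upper_to_ln:
  assumes "\<exists>C>0. \<forall>n\<ge>1. N n \<le> ereal (C * (g n * harm n powr s))" "\<And>n. 0 \<le> g n"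
  shows "\<exists>C>0. \<forall>n\<ge>1. N n \<le> ereal (C * (g n * ln (real n + 1) powr s))"
proof -
  obtain C where C: "C > 0" "\<And>n. n \<ge> 1 \<Longrightarrow> N n \<le> ereal (C * (g n * harm n powr s))"
    using assms(1) by auto
  obtain D where D: "D > 0" "\<And>n. n \<ge> 1 \<Longrightarrow> harm n powr s \<le> D * ln (real n + 1) powr s"
    using harm_powr_asymp_ln[of s] by auto
  have "N n \<le> ereal (C * D * (g n * ln (real n + 1) powr s))" if n: "n \<ge> 1" for n
  proof -
    have "C * (g n * harm n powr s) \<le> C * (g n * (D * ln (real n + 1) powr s))"
      using D(2)[OF n] C(1) assms(2) by (intro mult_left_mono) auto
    with C(2)[OF n] show ?thesis by (simp add: mult_ac order_trans)
  qed
  then show ?thesis using C(1) D(1) by (intro exI[of _ "C * D"]) auto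
qed

lemma harm_lower_to_ln:
  assumes "\<exists>c>0. \<forall>n\<ge>1. ereal (c * (g n * harm n powr s)) \<le> N n" "\<And>n. 0 \<le> g n"
  shows "\<exists>c>0. \<forall>n\<ge>1. ereal (c * (g n * ln (real n + 1) powr s)) \<le> N n"
proof -
  obtain c where c: "c > 0" "\<And>n. n \<ge> 1 \<Longrightarrow> ereal (c * (g n * harm n powr s)) \<le> N n"
    using assms(1) by auto
  obtain d where d: "d > 0" "\<And>n. n \<ge> 1 \<Longrightarrow> d * ln (real n + 1) powr s \<le> harm n powr s"
    using harm_powr_asymp_ln[of s] by auto
  have "ereal (c * d * (g n * ln (real n + 1) powr s)) \<le> N n" if n: "n \<ge> 1" for n
  proof -
    have "c * (g n * (d * ln (real n + 1) powr s)) \<le> c * (g n * harm n powr s)"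
      using d(2)[OF n] c(1) assms(2) by (intro mult_left_mono) auto
    then have "ereal (c * (g n * (d * ln (real n + 1) powr s))) \<le> N n"
      using c(2)[OF n] by (meson ereal_less_eq(3) order_trans)
    then show ?thesis by (simp add: mult_ac)
  qed
  then show ?thesis using c(1) d(1) by (intro exI[of _ "c * d"]) auto
qed

theorem proposition2:
  fixes p q u v :: ereal
  assumes "0 < p" and "0 < q" and "0 < u" and "0 < v"
  shows "\<exists>c C :: real. 0 < c \<and> 0 < C \<and>
    (\<forall>n \<ge> 1. ereal (c * lorentz_id_rate n p u q v) \<le> lorentz_id_norm n p u q v \<and>
             lorentz_id_norm n p u q v \<le> ereal (C * lorentz_id_rate n p u q v))"
proof -
  have trivial_lower: "\<exists>c>0. \<forall>n\<ge>1. ereal (c * lorentz_id_rate n p u q v) \<le> lorentz_id_norm n p u q v"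
    if "\<And>n. n \<ge> 1 \<Longrightarrow> lorentz_id_rate n p u q v = 1"
    using that lorentz_id_norm_ge_1[OF assms(3,4)] by (intro exI[of _ 1]) (auto simp: one_ereal_def)
  have "(\<exists>c>0. \<forall>n\<ge>1. ereal (c * lorentz_id_rate n p u q v) \<le> lorentz_id_norm n p u q v) \<and>
    (\<exists>C>0. \<forall>n\<ge>1. lorentz_id_norm n p u q v \<le> ereal (C * lorentz_id_rate n p u q v))"
  proof (cases "p = q")
    case True
    then have rate: "lorentz_id_rate n p u q v = ln (real n + 1) powr max 0 (recip v - recip u)" for n
      by (simp add: lorentz_id_rate_def)
    have "\<exists>c>0. \<forall>n\<ge>1. ereal (c * lorentz_id_rate n p u q v) \<le> lorentz_id_norm n p u q v"
    proof (cases "recip v \<le> recip u")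
      case le: True
      then show ?thesis by (intro trivial_lower) (simp add: rate)
    next
      case False
      \<comment> \<open>The factor 1 plays the part of \<open>g n\<close> in
        \<open>harm_lower_to_ln\<close>.\<close>
      have "\<exists>c>0. \<forall>n\<ge>1. ereal (c * (1 * harm n powr (recip v - recip u))) \<le> lorentz_id_norm n p u q v"
        using lorentz_id_norm_lower_eq[OF assms(3,4,1)] True by (intro exI[of _ 1]) auto
      from harm_lower_to_ln[OF this] False show ?thesis by (simp add: rate)
    qed
    moreover have "\<exists>C>0. \<forall>n\<ge>1. lorentz_id_norm n p u q v \<le> ereal (C * (1 * harm n powr max 0 (recip v - recip u)))"
      using lorentz_id_norm_upper_eq[OF assms(3,4,1)] True by simp
    from harm_upper_to_ln[OF this]
    have "\<exists>C>0. \<forall>n\<ge>1. lorentz_id_norm n p u q v \<le> ereal (C * lorentz_id_rate n p u q v)"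
      by (simp add: rate)
    ultimately show ?thesis ..
  next
    case neq: False
    have recip_q: "0 \<le> recip q" using assms by (simp add: recip_nonneg)
    show ?thesis
    proof (cases "p = \<infinity>")
      case True
      with neq obtain Q where Q: "q = ereal Q" "0 < Q" using assms by (cases q) auto
      have rate: "lorentz_id_rate n p u q v = real n powr recip q * ln (real n + 1) powr (- recip u)" for n
        using True Q by (simp add: lorentz_id_rate_def)
      show ?thesis unfolding rate
        using lorentz_id_norm_lower_top[OF assms(3,4), of p q] lorentz_id_norm_upper_top[OF assms(3,4), of p q] True Q
        by (intro conjI harm_lower_to_ln harm_upper_to_ln) auto
    next
      case False
      then obtain P where P: "p = ereal P" "0 < P" using assms by (cases p) auto
      \<comment> \<open>The branch \<open>q = \<infinity>\<close> has rate 1, which is n^0 because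
        \<open>max 0 (- recip p) = 0\<close>; \<open>n \<ge> 1\<close> matters, as
        \<open>0 powr 0 = 0\<close>.\<close>
      have rate: "lorentz_id_rate n p u q v = real n powr max 0 (recip q - recip p)" if "n \<ge> 1" for n
      proof (cases "q = \<infinity>")
        case True
        then show ?thesis using P that by (simp add: lorentz_id_rate_def)
      next
        case False
        then show ?thesis using P neq by (simp add: lorentz_id_rate_def less_top[symmetric])
      qed
      have recip_p: "0 < recip p" using P by simp
      have ne: "recip p \<noteq> recip q" using P neq assms by (cases q) auto
      have "\<exists>c>0. \<forall>n\<ge>1. ereal (c * lorentz_id_rate n p u q v) \<le> lorentz_id_norm n p u q v"
      proof (cases "recip q \<le> recip p")
        case True
        then show ?thesis by (intro trivial_lower) (simp add: rate)
      next
        case False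
        then show ?thesis using lorentz_id_norm_lower_powr[OF assms(3,4) recip_p recip_q] by (simp add: rate)
      qed
      moreover have "\<exists>C>0. \<forall>n\<ge>1. lorentz_id_norm n p u q v \<le> ereal (C * lorentz_id_rate n p u q v)"
        using lorentz_id_norm_upper_powr[OF assms(3,4) recip_p ne] by (simp add: rate)
      ultimately show ?thesis ..
    qed
  qed
  then show ?thesis by blast
qed

end
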